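(* Let $d\ge 2$ be fixed. For every sufficiently large finite set $E\subseteq\mathbb R^d$ with $|E|=n$, there exists a point $x\in E$ such that \[\left|\{x\cdot y: y\in E\}\right|\gtrsim n^{\frac{2}{2d-1}},\] where the implied constant depends only on $d$.
   Context: $x\cdot y$ denotes the standard dot product on $\mathbb R^d$. The notation $X\gtrsim Y$ means $X\ge cY$ for some constant $c>0$. *)

theory Defs
  imports "HOL-Analysis.Analysis"
begin

end

theory Submission
  imports Defs
begin

text \<open>
  Let \<open>k\<close> be the largest pinned count. Choose a basis of the span of \<open>E\<close> inside \<open>E\<close> and fix the
  dot products with all but two basis vectors; some fibre \<open>S\<close> has at least \<open>n / k ^ (d - 2)\<close> points.
  On \<open>S\<close> every \<open>x \<in> S\<close> acts, up to a constant, as a linear functional of the two remaining dot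
  products, so the points of \<open>S\<close>, viewed in the plane, are covered by at most \<open>k\<close> parallel lines in
  the direction determined by \<open>x\<close>. Points giving the same direction have distinct dot products with
  one of them, so there are at least \<open>(|S| - 1) / k\<close> directions. Szekely's crossing argument, applied
  to the segments joining consecutive points of \<open>S\<close> on these lines, bounds \<open>|S|\<close> times the number of
  directions by a multiple of \<open>k ^ 2\<close>, whence \<open>|S| ^ 2 \<lesssim> k ^ 3\<close> and \<open>n ^ 2 \<lesssim> k ^ (2 * d - 1)\<close>.
\<close>

section \<open>Plane straight-line graphs\<close>

definition left :: "(real \<times> real) \<times> (real \<times> real) \<Rightarrow> real"
  where "left e = fst (fst e)"

definition right :: "(real \<times> real) \<times> (real \<times> real) \<Rightarrow> real"
  where "right e = fst (snd e)"

definition slope :: "(real \<times> real) \<times> (real \<times> real) \<Rightarrow> real"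
  where "slope e = (snd (snd e) - snd (fst e)) / (right e - left e)"

definition height :: "(real \<times> real) \<times> (real \<times> real) \<Rightarrow> real \<Rightarrow> real"
  where "height e x = snd (fst e) + slope e * (x - left e)"

text \<open>Only interior abscissas count: edges that merely share an endpoint do not cross, whereas
  overlapping collinear ones do.\<close>

definition crossing :: "(real \<times> real) \<times> (real \<times> real) \<Rightarrow> (real \<times> real) \<times> (real \<times> real) \<Rightarrow> bool"
  where "crossing e f \<longleftrightarrow>
    (\<exists>x. left e < x \<and> x < right e \<and> left f < x \<and> x < right f \<and> height e x = height f x)"

lemma height_left: "height e (left e) = snd (fst e)"
  by (simp add: height_def)

lemma height_right: "left e < right e \<Longrightarrow> height e (right e) = snd (snd e)"
  by (simp add: height_def slope_def)

lemma height_shift: "height e y = height e x + slope e * (y - x)"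
  by (simp add: height_def algebra_simps)

lemma crossingI_sign_change:
  assumes "x < y" "height e x < height f x" "height f y < height e y"
    and "left e \<le> x" "y \<le> right e" "left f \<le> x" "y \<le> right f"
  shows "crossing e f"
proof -
  have "continuous_on {x..y} (\<lambda>z. height e z - height f z)"
    unfolding height_def by (intro continuous_intros)
  then obtain z where z: "x \<le> z" "z \<le> y" "height e z - height f z = 0"
    using IVT'[of "\<lambda>z. height e z - height f z" x 0 y] assms by auto
  moreover have "z \<noteq> x" "z \<noteq> y"
    using z assms by auto
  ultimately show ?thesis
    unfolding crossing_def using assms by (intro exI[of _ z]) auto
qed

text \<open>Distinct abscissas let an abscissa identify a vertex. A vertex inside an edge need not
  produce a \<open>crossing\<close>, hence the separate \<open>vertex_not_on_edge\<close>.\<close>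

locale plane_graph =
  fixes V :: "(real \<times> real) set" and F :: "((real \<times> real) \<times> (real \<times> real)) set"
  assumes finite_V: "finite V"
    and inj_V: "inj_on fst V"
    and F_sub: "F \<subseteq> V \<times> V"
    and left_less_right: "e \<in> F \<Longrightarrow> left e < right e"
    and not_crossing: "e \<in> F \<Longrightarrow> f \<in> F \<Longrightarrow> crossing e f \<Longrightarrow> e = f"
    and vertex_not_on_edge:
      "e \<in> F \<Longrightarrow> v \<in> V \<Longrightarrow> left e < fst v \<Longrightarrow> fst v < right e \<Longrightarrow> snd v \<noteq> height e (fst v)"
begin

lemma finite_F: "finite F"
  using finite_subset[OF F_sub] finite_V by auto

lemma endpoints: "e \<in> F \<Longrightarrow> fst e \<in> V" "e \<in> F \<Longrightarrow> snd e \<in> V"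
  using F_sub by (auto simp: mem_Times_iff)

lemma fst_eqI: "e \<in> F \<Longrightarrow> f \<in> F \<Longrightarrow> left e = left f \<Longrightarrow> fst e = fst f"
  using inj_onD[OF inj_V, of "fst e" "fst f"] endpoints(1)[of e] endpoints(1)[of f]
  by (simp add: left_def)

lemma snd_eqI: "e \<in> F \<Longrightarrow> f \<in> F \<Longrightarrow> right e = right f \<Longrightarrow> snd e = snd f"
  using inj_onD[OF inj_V, of "snd e" "snd f"] endpoints(2)[of e] endpoints(2)[of f]
  by (simp add: right_def)

lemma no_sign_change:
  assumes "e \<in> F" "f \<in> F" "x < y" "height e x < height f x" "height f y < height e y"
    and "left e \<le> x" "y \<le> right e" "left f \<le> x" "y \<le> right f"
  shows False
  using not_crossing[OF assms(1,2) crossingI_sign_change] assms by auto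

section \<open>Charging the edges of a plane graph to its vertices\<close>

definition lowest_right :: "((real \<times> real) \<times> (real \<times> real)) set"
  where "lowest_right = {e \<in> F. \<forall>f \<in> F. fst f = fst e \<longrightarrow> slope e \<le> slope f}"

text \<open>Seen from a common right end, the edge of largest slope is the lowest one.\<close>

definition lowest_left :: "((real \<times> real) \<times> (real \<times> real)) set"
  where "lowest_left = {e \<in> F. \<forall>f \<in> F. snd f = snd e \<longrightarrow> slope f \<le> slope e}"

definition above :: "(real \<times> real) \<Rightarrow> (real \<times> real) \<times> (real \<times> real) \<Rightarrow> bool"
  where "above w e \<longleftrightarrow> left e < fst w \<and> fst w < right e \<and> snd w < height e (fst w)"

definition directly_above :: "(real \<times> real) \<Rightarrow> (real \<times> real) \<times> (real \<times> real) \<Rightarrow> bool"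
  where "directly_above w e \<longleftrightarrow>
    above w e \<and> (\<forall>h \<in> F. above w h \<longrightarrow> height e (fst w) \<le> height h (fst w))"

text \<open>Two edges leaving a vertex to the right with equal slopes overlap just after it, so they
  cross; hence each vertex is charged at most once.\<close>

lemma card_lowest_right: "card lowest_right \<le> card V"
proof (rule card_inj_on_le[where f = fst])
  show "inj_on fst lowest_right"
  proof (rule inj_onI)
    fix e f assume ef: "e \<in> lowest_right" "f \<in> lowest_right" "fst e = fst f"
    then have F: "e \<in> F" "f \<in> F" and "slope e = slope f"
      by (auto simp: lowest_right_def intro: antisym)
    moreover have "left e = left f"
      using ef by (simp add: left_def)
    ultimately have h: "height e x = height f x" for x
      using ef(3) by (simp add: height_def)
    obtain x where "left e < x" "x < min (right e) (right f)"
      using dense[of "left e" "min (right e) (right f)"] left_less_right[OF F(1)] left_less_right[OF F(2)] \<open>left e = left f\<close>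
      by auto
    then have "crossing e f"
      unfolding crossing_def using h \<open>left e = left f\<close> by (intro exI[of _ x]) auto
    then show "e = f" using not_crossing F by blast
  qed
  show "fst ` lowest_right \<subseteq> V"
    unfolding lowest_right_def using endpoints(1) by blast
qed (rule finite_V)

lemma card_lowest_left: "card lowest_left \<le> card V"
proof (rule card_inj_on_le[where f = snd])
  show "inj_on snd lowest_left"
  proof (rule inj_onI)
    fix e f assume ef: "e \<in> lowest_left" "f \<in> lowest_left" "snd e = snd f"
    then have F: "e \<in> F" "f \<in> F" and s: "slope e = slope f"
      by (auto simp: lowest_left_def intro: antisym)
    have r: "right e = right f"
      using ef by (simp add: right_def)
    have h: "height e x = height f x" for x
      using height_shift[of e x "right e"] height_shift[of f x "right f"] s r ef(3)
        height_right[OF left_less_right[OF F(1)]] height_right[OF left_less_right[OF F(2)]]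
      by simp
    obtain x where "max (left e) (left f) < x" "x < right e"
      using dense[of "max (left e) (left f)" "right e"] left_less_right[OF F(1)] left_less_right[OF F(2)] r
      by auto
    then have "crossing e f"
      unfolding crossing_def using h r by (intro exI[of _ x]) auto
    then show "e = f" using not_crossing F by blast
  qed
  show "snd ` lowest_left \<subseteq> V"
    unfolding lowest_left_def using endpoints(2) by blast
qed (rule finite_V)

lemma directly_above_unique:
  assumes "e \<in> F" "f \<in> F" "directly_above w e" "directly_above w f"
  shows "e = f"
proof -
  have "height e (fst w) = height f (fst w)"
    using assms by (auto simp: directly_above_def intro: antisym)
  then have "crossing e f"
    unfolding crossing_def using assms
    by (intro exI[of _ "fst w"]) (auto simp: directly_above_def above_def)
  then show ?thesis using not_crossing assms by blast
qed

lemma card_directly_above: "card {e \<in> F. \<exists>w \<in> V. directly_above w e} \<le> card V"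
proof (rule surj_card_le[where f = "\<lambda>w. THE e. e \<in> F \<and> directly_above w e"])
  show "{e \<in> F. \<exists>w \<in> V. directly_above w e}
      \<subseteq> (\<lambda>w. THE e. e \<in> F \<and> directly_above w e) ` V"
  proof
    fix e assume "e \<in> {e \<in> F. \<exists>w \<in> V. directly_above w e}"
    then obtain w where w: "e \<in> F" "w \<in> V" "directly_above w e" by blast
    show "e \<in> (\<lambda>w. THE e. e \<in> F \<and> directly_above w e) ` V"
    proof (rule image_eqI)
      show "e = (THE e. e \<in> F \<and> directly_above w e)"
        by (rule the_equality[symmetric]) (use w directly_above_unique in blast)+
    qed (rule w)
  qed
qed (rule finite_V)

text \<open>If \<open>e\<close> is not the lowest edge at either end, let \<open>f\<close> be the next edge below \<open>e\<close> at the left end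
  of \<open>e\<close>. The leftmost vertex \<open>w\<close> in the wedge between \<open>f\<close> and \<open>e\<close> has \<open>e\<close> directly above it.\<close>

lemma edge_cases:
  assumes e: "e \<in> F"
  shows "e \<in> lowest_right \<or> e \<in> lowest_left \<or> (\<exists>w \<in> V. directly_above w e)"
proof (rule disjCI, rule ccontr)
  assume "\<not> (e \<in> lowest_left \<or> (\<exists>w \<in> V. directly_above w e))" 
  then have nl: "e \<notin> lowest_left" and nd: "\<not> (\<exists>w \<in> V. directly_above w e)" by auto
  assume "e \<notin> lowest_right" 
  define G where "G = {f \<in> F. fst f = fst e \<and> slope f < slope e}"
  have "\<exists>f \<in> F. fst f = fst e \<and> slope f < slope e"
    using \<open>e \<notin> lowest_right\<close> e by (simp add: lowest_right_def not_le)
  then have "G \<noteq> {}"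
    unfolding G_def by blast
  have "finite G"
    using finite_F unfolding G_def by auto
  with \<open>G \<noteq> {}\<close> have "Max (slope ` G) \<in> slope ` G" by (intro Max_in) auto
  then obtain f where "f \<in> G" and fmax: "slope f = Max (slope ` G)" by auto
  then have f: "f \<in> F" "fst f = fst e" "slope f < slope e" by (auto simp: G_def)
  have fmax: "slope h \<le> slope f" if "h \<in> F" "fst h = fst e" "slope h < slope e" for h
    unfolding fmax using that \<open>finite G\<close> by (intro Max_ge) (auto simp: G_def)
  have lf: "left f = left e" using f by (simp add: left_def)
  have fe: "height f x < height e x" if "left e < x" for x
    using that f lf by (simp add: height_def)
  \<comment> \<open>\<open>g\<close> arrives at the right end of \<open>e\<close> from
    below.\<close>
  obtain g where g: "g \<in> F" "snd g = snd e" "slope e < slope g"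
    using nl e by (auto simp: lowest_left_def not_le)
  have rg: "right g = right e" using g by (simp add: right_def)
  have hre: "height g (right e) = height e (right e)"
    using height_right[OF left_less_right[OF e]] height_right[OF left_less_right[OF g(1)]] rg g
    by simp
  have ge: "height g x < height e x" if "x < right e" for x
  proof -
    have "height g x - height e x = (slope g - slope e) * (x - right e)"
      using height_shift[of g x "right e"] height_shift[of e x "right e"] hre
      by (simp add: algebra_simps)
    also have "\<dots> < 0" using that g by (simp add: mult_pos_neg)
    finally show ?thesis by simp
  qed
  \<comment> \<open>Vertices of the wedge: strictly below \<open>e\<close>, but possibly on
    \<open>f\<close>, so that the right end of \<open>f\<close> qualifies.\<close>
  define W where "W = {w \<in> V. above w e \<and> fst w \<le> right f \<and> height f (fst w) \<le> snd w}"
  have "W \<noteq> {}"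
  proof (cases "right f < right e")
    case True
    have "snd (snd f) = height f (right f)"
      using height_right left_less_right f by simp
    then have "snd f \<in> W"
      using True f fe[of "right f"] left_less_right[OF f(1)] lf endpoints(2)[OF f(1)]
      by (simp add: W_def above_def right_def)
    then show ?thesis by blast
  next
    case False
    have "right f \<noteq> right e"
    proof
      assume "right f = right e"
      then have "snd f = snd e"
        using snd_eqI f e by blast
      then have "f = e" using f by (simp add: prod_eq_iff)
      then show False using f by simp
    qed
    with False have rr: "right e < right f" by simp
    have fr: "height f (right e) < height g (right e)"
      using fe[of "right e"] left_less_right[OF e] hre by simp
    \<comment> \<open>When \<open>f\<close> extends beyond \<open>e\<close>, the left end of
      \<open>g\<close> is the vertex sought. At the right end of \<open>e\<close>, \<open>g\<close>
      is above \<open>f\<close>; starting to the left of \<open>e\<close> or below \<open>f\<close>,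
      it would have to cross \<open>f\<close>.\<close>
    have lg: "left e < left g"
    proof (rule ccontr)
      assume "\<not> left e < left g"
      moreover have "left e \<noteq> left g"
      proof
        assume "left e = left g"
        then have "fst g = fst e"
          using fst_eqI g e by metis
        then have "g = e" using g by (simp add: prod_eq_iff)
        then show False using g by simp
      qed
      ultimately have "left g < left e" by simp
      moreover have "height g (left e) < height f (left e)"
        using ge[of "left e"] left_less_right[OF e] lf f height_left[of e] height_left[of f] by simp
      ultimately show False
        using no_sign_change[OF g(1) f(1) left_less_right[OF e]] fr rr rg lf by simp
    qed
    have "height f (left g) \<le> snd (fst g)"
    proof (rule ccontr)
      assume "\<not> height f (left g) \<le> snd (fst g)"
      then have "height g (left g) < height f (left g)" by (simp add: height_left)
      then show False
        using no_sign_change[OF g(1) f(1), of "left g" "right e"] left_less_right[OF g(1)]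
          fr rr rg lf lg by simp
    qed
    then have "fst g \<in> W"
      using lg rg rr left_less_right[OF g(1)] endpoints(1)[OF g(1)] ge[of "left g"] height_left[of g]
      by (simp add: W_def above_def left_def)
    then show ?thesis by blast
  qed
  moreover have "finite W" using finite_V by (simp add: W_def)
  ultimately have "Min (fst ` W) \<in> fst ` W" by (intro Min_in) auto
  then obtain w where w: "w \<in> W" and "fst w = Min (fst ` W)" by auto
  then have wmin: "fst w \<le> fst v" if "v \<in> W" for v
    using that \<open>finite W\<close> by simp
  from w have wV: "w \<in> V" and we: "left e < fst w" "fst w < right e" "snd w < height e (fst w)"
    and wf: "fst w \<le> right f" "height f (fst w) \<le> snd w"
    by (auto simp: W_def above_def)
  \<comment> \<open>As \<open>e\<close> is not directly above \<open>w\<close>, some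
    \<open>h\<close> passes between them. To the left of \<open>w\<close> it stays trapped between
    \<open>f\<close> and \<open>e\<close>, and every position of its left end is
    contradictory.\<close>
  obtain h where h: "h \<in> F" "left h < fst w" "fst w < right h" "snd w < height h (fst w)"
    "height h (fst w) < height e (fst w)"
    using nd wV we by (auto simp: directly_above_def above_def not_le)
  have he: "height h x \<le> height e x" if "left h \<le> x" "left e \<le> x" "x < fst w" for x
    by (rule ccontr, rule no_sign_change[OF e h(1) that(3)]) (use that h we in simp_all)
  have hf: "height f x \<le> height h x" if "left h \<le> x" "left e \<le> x" "x < fst w" for x
    by (rule ccontr, rule no_sign_change[OF h(1) f(1) that(3)]) (use that h we lf wf in simp_all)
  consider "left h < left e" | "left h = left e" | "left e < left h" by linarith
  then show False
  proof cases
    case 1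
    \<comment> \<open>Squeezed between \<open>f\<close> and \<open>e\<close> where these meet,
      \<open>h\<close> would run through a vertex.\<close>
    have "height h (left e) = height e (left e)"
      using he[of "left e"] hf[of "left e"] 1 we lf f height_left[of e] height_left[of f]
      by simp
    then show False
      using vertex_not_on_edge[OF h(1) endpoints(1)[OF e]] 1 we h height_left[of e]
      by (simp add: left_def)
  next
    case 2
    then have fh: "fst h = fst e"
      using fst_eqI h e by blast
    \<comment> \<open>\<open>h\<close> would leave the common left end strictly between
      \<open>f\<close> and \<open>e\<close>, against the choice of \<open>f\<close>.\<close>
    have "slope h < slope e"
      using h(5) fh 2 we by (simp add: height_def)
    moreover have "slope f < slope h"
    proof -
      have "height f (fst w) < height h (fst w)" using wf h by simp
      then show ?thesis using fh f 2 lf we by (simp add: height_def)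
    qed
    ultimately show False using fmax[OF h(1) fh] by simp
  next
    case 3
    \<comment> \<open>The left end of \<open>h\<close> would be a vertex of the wedge further left
      than \<open>w\<close>.\<close>
    have "snd (fst h) \<noteq> height e (left h)"
      using vertex_not_on_edge[OF e endpoints(1)[OF h(1)]] 3 we h by (simp add: left_def)
    then have "height h (left h) < height e (left h)" "height f (left h) \<le> height h (left h)"
      using he[of "left h"] hf[of "left h"] 3 h height_left[of h] by simp_all
    then have "fst h \<in> W"
      using endpoints(1)[OF h(1)] h 3 we wf height_left[of h] by (simp add: W_def above_def left_def)
    then show False using wmin[of "fst h"] h(2) by (simp add: left_def)
  qed
qed

text \<open>The linear bound usually drawn from Euler's formula: three classes cover the edges, and
  each class charges a vertex at most once.\<close>

lemma card_edges_le: "card F \<le> 3 * card V"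
proof -
  have "F \<subseteq> lowest_right \<union> lowest_left \<union> {e \<in> F. \<exists>w \<in> V. directly_above w e}"
    using edge_cases by blast
  then have "card F \<le> card (lowest_right \<union> lowest_left \<union> {e \<in> F. \<exists>w \<in> V. directly_above w e})"
    using finite_F by (intro card_mono) (auto simp: lowest_right_def lowest_left_def)
  also have "\<dots> \<le> card lowest_right + card lowest_left + card {e \<in> F. \<exists>w \<in> V. directly_above w e}"
    by (meson card_Un_le add_le_mono order_refl order_trans)
  finally show ?thesis
    using card_lowest_right card_lowest_left card_directly_above by simp
qed

end

section \<open>Amplification by random vertex subsets\<close>

text \<open>The values on \<open>V - A\<close> are free. In product form, this is the probability
  \<open>1 / q ^ card A\<close> that a random \<open>f\<close> vanishes on \<open>A\<close>.\<close>

lemma card_PiE_constant_on: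
  assumes V: "finite V" and A: "A \<subseteq> V" and q: "q \<ge> (1::nat)"
  shows "card {f \<in> V \<rightarrow>\<^sub>E {..<q}. \<forall>a\<in>A. f a = 0} * q ^ card A = q ^ card V"
proof -
  have "{f \<in> V \<rightarrow>\<^sub>E {..<q}. \<forall>a\<in>A. f a = 0} = PiE V (\<lambda>v. if v \<in> A then {0} else {..<q})"
  proof (intro set_eqI iffI)
    fix f assume "f \<in> PiE V (\<lambda>v. if v \<in> A then {0} else {..<q})"
    then have "f \<in> extensional V" and f: "\<And>v. v \<in> V \<Longrightarrow> f v \<in> (if v \<in> A then {0} else {..<q})"
      by (simp_all only: PiE_iff)
    have "f v < q" if "v \<in> V" for v
      using f[OF that] q by (cases "v \<in> A") auto
    moreover have "f v = 0" if "v \<in> A" for v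
      using f[of v] that A by auto
    ultimately show "f \<in> {f \<in> V \<rightarrow>\<^sub>E {..<q}. \<forall>a\<in>A. f a = 0}"
      using \<open>f \<in> extensional V\<close> by (simp add: PiE_iff)
  qed (auto simp: PiE_iff)
  then have "card {f \<in> V \<rightarrow>\<^sub>E {..<q}. \<forall>a\<in>A. f a = 0} = (\<Prod>v\<in>V. if v \<in> A then 1 else q)"
    using V by (simp add: card_PiE if_distrib cong: if_cong)
  also have "\<dots> = q ^ card (V - A)"
    using V by (simp add: prod.If_cases Diff_eq)
  finally have "card {f \<in> V \<rightarrow>\<^sub>E {..<q}. \<forall>a\<in>A. f a = 0} = q ^ card (V - A)" .
  moreover have "card (V - A) + card A = card V"
    using card_Diff_subset[OF finite_subset[OF A V] A] card_mono[OF V A] by simp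
  ultimately show ?thesis by (simp flip: power_add)
qed

text \<open>Linearity of expectation with cleared denominators, by double counting: each
  \<open>i\<close> survives with probability \<open>1 / q ^ j\<close>.\<close>

lemma sum_card_supported:
  assumes V: "finite V" and q: "q \<ge> (1::nat)" and I: "finite I"
    and s: "\<And>i. i \<in> I \<Longrightarrow> s i \<subseteq> V \<and> card (s i) = j"
  shows "(\<Sum>f\<in>V \<rightarrow>\<^sub>E {..<q}. card {i\<in>I. \<forall>a\<in>s i. f a = 0}) * q ^ j = card I * q ^ card V"
proof -
  let ?O = "V \<rightarrow>\<^sub>E {..<q}"
  have fO: "finite ?O" using V by (simp add: finite_PiE)
  have "(\<Sum>f\<in>?O. card {i\<in>I. \<forall>a\<in>s i. f a = 0}) = (\<Sum>i\<in>I. card {f\<in>?O. \<forall>a\<in>s i. f a = 0})"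
    using sum.swap_restrict[OF fO I, of "\<lambda>_ _. 1::nat" "\<lambda>f i. \<forall>a\<in>s i. f a = 0"]
    by simp
  then have "(\<Sum>f\<in>?O. card {i\<in>I. \<forall>a\<in>s i. f a = 0}) * q ^ j
      = (\<Sum>i\<in>I. card {f\<in>?O. \<forall>a\<in>s i. f a = 0} * q ^ card (s i))"
    using s by (simp add: sum_distrib_right)
  also have "\<dots> = (\<Sum>i\<in>I. q ^ card V)"
    by (rule sum.cong) (use s card_PiE_constant_on[OF V _ q] in blast)+
  finally show ?thesis by simp
qed

text \<open>The zero set of a uniformly random \<open>f : V \<rightarrow> {..<q}\<close> contains each vertex independently with
  probability \<open>1 / q\<close>; summing the linear bound over all \<open>f\<close> is taking its expectation.\<close>

lemma crossing_amplification:
  fixes V :: "'a set" and F :: "('a \<times> 'a) set" and X :: "(('a \<times> 'a) \<times> ('a \<times> 'a)) set"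
  assumes V: "finite V" and F: "F \<subseteq> V \<times> V" and Fd: "\<And>a b. (a, b) \<in> F \<Longrightarrow> a \<noteq> b"
    and X: "X \<subseteq> F \<times> F"
    and Xd: "\<And>a b c d. ((a, b), (c, d)) \<in> X \<Longrightarrow> distinct [a, b, c, d]"
    and bound: "\<And>S. S \<subseteq> V \<Longrightarrow>
      card (F \<inter> S \<times> S) \<le> 3 * card S + card (X \<inter> (S \<times> S) \<times> (S \<times> S))"
    and q: "q \<ge> (1::nat)"
  shows "card F * q ^ 2 \<le> 3 * card V * q ^ 3 + card X"
proof -
  let ?O = "V \<rightarrow>\<^sub>E {..<q}"
  define S where "S f = {v\<in>V. f v = (0::nat)}" for f
  have fF: "finite F" using finite_subset[OF F] V by simp
  have fX: "finite X" using finite_subset[OF X] fF by simp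
  \<comment> \<open>An edge survives when its two ends are sampled, a crossing pair when its four
    distinct ends are.\<close>
  define sE where "sE e = {fst e, snd e}" for e :: "'a \<times> 'a"
  define sX where "sX x = {fst (fst x), snd (fst x), fst (snd x), snd (snd x)}"
    for x :: "('a \<times> 'a) \<times> ('a \<times> 'a)"
  have eV: "(\<Sum>f\<in>?O. card (S f)) * q = card V * q ^ card V"
    using sum_card_supported[OF V q V, of "\<lambda>v. {v}" 1] by (simp add: S_def)
  have "{e\<in>F. \<forall>a\<in>sE e. f a = 0} = F \<inter> S f \<times> S f" for f :: "'a \<Rightarrow> nat"
    using F by (auto simp: sE_def S_def)
  moreover have "sE e \<subseteq> V \<and> card (sE e) = 2" if "e \<in> F" for e
    using that F Fd[of "fst e" "snd e"] by (auto simp: sE_def)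
  ultimately have eF: "(\<Sum>f\<in>?O. card (F \<inter> S f \<times> S f)) * q ^ 2 = card F * q ^ card V"
    using sum_card_supported[OF V q fF, of sE 2] by simp
  have "{x\<in>X. \<forall>a\<in>sX x. f a = 0} = X \<inter> (S f \<times> S f) \<times> (S f \<times> S f)" for f :: "'a \<Rightarrow> nat"
  proof -
    have "X \<subseteq> (V \<times> V) \<times> (V \<times> V)" using F X by blast
    then show ?thesis by (auto simp: sX_def S_def)
  qed
  moreover have "sX x \<subseteq> V \<and> card (sX x) = 4" if "x \<in> X" for x
  proof -
    obtain a b c d where x: "x = ((a, b), (c, d))" by (metis prod.exhaust)
    then have "distinct [a, b, c, d]" using Xd that by simp
    moreover have "(a, b) \<in> F" "(c, d) \<in> F" using X that x by auto
    ultimately show ?thesis using F by (auto simp: sX_def x)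
  qed
  ultimately have eX: "(\<Sum>f\<in>?O. card (X \<inter> (S f \<times> S f) \<times> (S f \<times> S f))) * q ^ 4 = card X * q ^ card V"
    using sum_card_supported[OF V q fX, of sX 4] by simp
  have "(\<Sum>f\<in>?O. card (F \<inter> S f \<times> S f))
      \<le> (\<Sum>f\<in>?O. 3 * card (S f) + card (X \<inter> (S f \<times> S f) \<times> (S f \<times> S f)))"
    by (intro sum_mono bound) (auto simp: S_def)
  also have "\<dots> = 3 * (\<Sum>f\<in>?O. card (S f)) + (\<Sum>f\<in>?O. card (X \<inter> (S f \<times> S f) \<times> (S f \<times> S f)))"
    by (simp add: sum.distrib sum_distrib_left)
  \<comment> \<open>In expectation the bound reads
    \<open>card F / q ^ 2 \<le> 3 * card V / q + card X / q ^ 4\<close>; the factor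
    \<open>q ^ 4\<close> clears denominators.\<close>
  finally have "(\<Sum>f\<in>?O. card (F \<inter> S f \<times> S f)) * q ^ 4
      \<le> (3 * (\<Sum>f\<in>?O. card (S f)) + (\<Sum>f\<in>?O. card (X \<inter> (S f \<times> S f) \<times> (S f \<times> S f)))) * q ^ 4"
    by (rule mult_right_mono) simp
  also have "\<dots> = 3 * ((\<Sum>f\<in>?O. card (S f)) * q) * q ^ 3
      + (\<Sum>f\<in>?O. card (X \<inter> (S f \<times> S f) \<times> (S f \<times> S f))) * q ^ 4"
    by (simp add: algebra_simps power_numeral_reduce)
  also have "(\<Sum>f\<in>?O. card (F \<inter> S f \<times> S f)) * q ^ 4
      = ((\<Sum>f\<in>?O. card (F \<inter> S f \<times> S f)) * q ^ 2) * q ^ 2"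
    by (simp flip: power_add)
  finally have "((\<Sum>f\<in>?O. card (F \<inter> S f \<times> S f)) * q ^ 2) * q ^ 2
      \<le> 3 * (card V * q ^ card V) * q ^ 3 + card X * q ^ card V"
    unfolding eV eX .
  then have "(card F * q ^ 2) * q ^ card V \<le> (3 * card V * q ^ 3 + card X) * q ^ card V"
    unfolding eF by (simp add: algebra_simps)
  then show ?thesis using q by simp
qed

section \<open>Points covered by few lines in many directions\<close>

lemma point_on_edge:
  assumes "left e < right e"
  shows "(x, height e x) = fst e + ((x - left e) / (right e - left e)) *\<^sub>R (snd e - fst e)"
  using assms by (simp add: prod_eq_iff height_def slope_def left_def right_def)

text \<open>The members of \<open>A\<close> act as normal vectors, whose level sets are parallel
  lines; \<open>transversal\<close> is pairwise linear independence.\<close>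

locale parallel_families =
  fixes P A :: "(real \<times> real) set" and k :: nat
  assumes finite_P: "finite P"
    and inj_P: "inj_on fst P"
    and finite_A: "finite A"
    and transversal: "a \<in> A \<Longrightarrow> b \<in> A \<Longrightarrow> a \<noteq> b \<Longrightarrow> a \<bullet> z = 0 \<Longrightarrow> b \<bullet> z = 0 \<Longrightarrow> z = 0"
    and card_levels: "a \<in> A \<Longrightarrow> card ((\<bullet>) a ` P) \<le> k"
begin

text \<open>Segments between consecutive points of \<open>P\<close> on a line with normal
  \<open>a\<close>, oriented from left to right.\<close>

definition edges :: "(real \<times> real) \<Rightarrow> ((real \<times> real) \<times> (real \<times> real)) set"
  where "edges a = {e \<in> P \<times> P. left e < right e \<and> a \<bullet> fst e = a \<bullet> snd e \<and>
    (\<forall>r\<in>P. a \<bullet> r = a \<bullet> fst e \<longrightarrow> \<not> (left e < fst r \<and> fst r < right e))}"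

definition all_edges :: "((real \<times> real) \<times> (real \<times> real)) set"
  where "all_edges = (\<Union>a\<in>A. edges a)"

definition crossing_pairs :: "(((real \<times> real) \<times> (real \<times> real)) \<times> ((real \<times> real) \<times> (real \<times> real))) set"
  where "crossing_pairs = {(e, f). e \<in> all_edges \<and> f \<in> all_edges \<and> e \<noteq> f \<and> crossing e f}"

lemma edgesD:
  assumes "e \<in> edges a"
  shows "fst e \<in> P" "snd e \<in> P" "left e < right e" "a \<bullet> snd e = a \<bullet> fst e"
    "\<And>r. r \<in> P \<Longrightarrow> a \<bullet> r = a \<bullet> fst e \<Longrightarrow> left e < fst r \<Longrightarrow> \<not> fst r < right e"
  using assms by (auto simp: edges_def)

lemma all_edges_sub: "all_edges \<subseteq> P \<times> P"
  by (auto simp: all_edges_def edges_def)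

lemma finite_all_edges: "finite all_edges"
  using finite_subset[OF all_edges_sub] finite_P by simp

lemma finite_edges: "finite (edges a)"
  by (rule finite_subset[of _ "P \<times> P"]) (use finite_P in \<open>auto simp: edges_def\<close>)

lemma finite_crossing_pairs: "finite crossing_pairs"
  by (rule finite_subset[of _ "all_edges \<times> all_edges"]) (use finite_all_edges in \<open>auto simp: crossing_pairs_def\<close>)

lemma level_on_edge:
  assumes "e \<in> edges a"
  shows "a \<bullet> (x, height e x) = a \<bullet> fst e"
  unfolding point_on_edge[OF edgesD(3)[OF assms]]
  by (simp only: inner_add_right inner_scaleR_right inner_diff_right edgesD(4)[OF assms])
    simp

text \<open>Otherwise an end of one segment would lie inside the other, whose ends are consecutive
  points of the line.\<close>

lemma overlapping_edges_eq:
  assumes e: "e \<in> edges a" and f: "f \<in> edges a" and lev: "a \<bullet> fst e = a \<bullet> fst f"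
    and x: "left e < x" "x < right e" "left f < x" "x < right f"
  shows "e = f"
proof -
  have "left e = left f"
    using edgesD(5)[OF e edgesD(1)[OF f]] edgesD(5)[OF f edgesD(1)[OF e]] lev x
    by (fastforce simp: left_def)
  moreover have "right e = right f"
    using edgesD(5)[OF e edgesD(2)[OF f]] edgesD(5)[OF f edgesD(2)[OF e]] lev x
      edgesD(4)[OF e] edgesD(4)[OF f]
    by (fastforce simp: right_def)
  ultimately show ?thesis
    using inj_P edgesD(1,2)[OF e] edgesD(1,2)[OF f]
    by (auto simp: left_def right_def prod_eq_iff dest: inj_onD)
qed

text \<open>Every point starts an edge unless it is the rightmost on its line, and there are at most
  \<open>k\<close> lines.\<close>

lemma card_edges_ge:
  assumes a: "a \<in> A"
  shows "card P \<le> card (edges a) + k"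
proof -
  define L where "L = {p \<in> P. \<forall>q\<in>P. a \<bullet> q = a \<bullet> p \<longrightarrow> fst q \<le> fst p}"
  have "inj_on ((\<bullet>) a) L"
  proof (rule inj_onI)
    fix p q assume pq: "p \<in> L" "q \<in> L" "a \<bullet> p = a \<bullet> q"
    then have "fst p = fst q" by (auto simp: L_def intro: antisym)
    then show "p = q" using pq inj_P by (auto simp: L_def dest: inj_onD)
  qed
  then have "card L \<le> card ((\<bullet>) a ` P)"
    using finite_P by (intro card_inj_on_le) (auto simp: L_def)
  then have "card L \<le> k" using card_levels[OF a] by simp
  moreover have "P - L \<subseteq> fst ` edges a"
  proof
    fix p assume p: "p \<in> P - L"
    define Q where "Q = {q \<in> P. a \<bullet> q = a \<bullet> p \<and> fst p < fst q}"
    have "\<exists>q\<in>P. a \<bullet> q = a \<bullet> p \<and> fst p < fst q"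
      using p by (simp add: L_def not_le)
    then have "Q \<noteq> {}" unfolding Q_def by blast
    moreover have "finite Q" using finite_P by (simp add: Q_def)
    ultimately have "Min (fst ` Q) \<in> fst ` Q" by (intro Min_in) auto
    then obtain q where q: "q \<in> Q" "fst q = Min (fst ` Q)" by auto
    have least: "fst q \<le> fst r" if "r \<in> Q" for r
      unfolding q(2) using that \<open>finite Q\<close> by simp
    have "\<not> (fst p < fst r \<and> fst r < fst q)" if "r \<in> P" "a \<bullet> r = a \<bullet> p" for r
      using least[of r] that by (cases "fst p < fst r") (simp_all add: Q_def not_less)
    then have "(p, q) \<in> edges a"
      using p q(1) by (simp add: edges_def Q_def left_def right_def)
    then show "p \<in> fst ` edges a" by (rule image_eqI[rotated]) simp
  qed
  then have "card (P - L) \<le> card (edges a)"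
    by (rule surj_card_le[OF finite_edges])
  moreover have "card P = card (P - L) + card L"
  proof -
    have "L \<subseteq> P" by (simp add: L_def)
    then show ?thesis
      using card_Diff_subset[of L P] card_mono[of P L] finite_P finite_subset[of L P] by simp
  qed
  ultimately show ?thesis by simp
qed

text \<open>The bounds for single normals add up, since an edge belonging to two normals would be
  orthogonal to both.\<close>

lemma card_all_edges_ge: "card A * card P \<le> card all_edges + card A * k"
proof -
  have "edges a \<inter> edges b = {}" if "a \<in> A" "b \<in> A" "a \<noteq> b" for a b
  proof -
    have "snd e - fst e = 0" if "e \<in> edges a" "e \<in> edges b" for e
      by (rule transversal[OF \<open>a \<in> A\<close> \<open>b \<in> A\<close> \<open>a \<noteq> b\<close>])
        (use edgesD(4)[OF that(1)] edgesD(4)[OF that(2)] in \<open>simp_all add: inner_diff_right\<close>)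
    moreover have "snd e - fst e \<noteq> 0" if "e \<in> edges a" for e
      using edgesD(3)[OF that] by (auto simp: left_def right_def)
    ultimately show ?thesis by blast
  qed
  then have "card all_edges = (\<Sum>a\<in>A. card (edges a))"
    unfolding all_edges_def using finite_A finite_edges by (intro card_UN_disjoint) auto
  moreover have "(\<Sum>a\<in>A. card P) \<le> (\<Sum>a\<in>A. card (edges a) + k)"
    by (rule sum_mono) (rule card_edges_ge)
  ultimately show ?thesis by (simp add: sum.distrib)
qed

text \<open>Edges with the same normal cannot cross: a common point puts them on one line, where
  overlapping edges coincide.\<close>

lemma crossing_pairs_cases:
  assumes "(e, f) \<in> crossing_pairs"
  obtains a b x where "a \<in> A" "b \<in> A" "a \<noteq> b" "e \<in> edges a" "f \<in> edges b"
    "left e < x" "x < right e" "left f < x" "x < right f" "height e x = height f x"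
proof -
  obtain a b where ab: "a \<in> A" "b \<in> A" "e \<in> edges a" "f \<in> edges b"
    using assms by (auto simp: crossing_pairs_def all_edges_def)
  obtain x where x: "left e < x" "x < right e" "left f < x" "x < right f" "height e x = height f x"
    using assms by (auto simp: crossing_pairs_def crossing_def)
  have "a \<noteq> b"
  proof
    assume "a = b"
    then have "a \<bullet> fst e = a \<bullet> fst f"
      using level_on_edge[OF ab(3), of x] level_on_edge[OF ab(4), of x] x by simp
    then have "e = f"
      using overlapping_edges_eq x ab \<open>a = b\<close> by blast
    then show False using assms by (simp add: crossing_pairs_def)
  qed
  then show thesis using that ab x by blast
qed

lemma meet_unique:
  assumes "a \<in> A" "b \<in> A" "a \<noteq> b" "a \<bullet> z = a \<bullet> w" "b \<bullet> z = b \<bullet> w"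
  shows "z = w"
  using transversal[OF assms(1-3), of "z - w"] assms(4,5) by (simp add: inner_diff_right)

text \<open>The sampling argument needs four distinct ends. A shared end would be the only common
  point of the two lines, but the crossing is interior to both edges.\<close>

lemma crossing_pairs_distinct:
  assumes "((p, q), (r, s)) \<in> crossing_pairs"
  shows "distinct [p, q, r, s]"
proof -
  obtain a b x where *: "a \<in> A" "b \<in> A" "a \<noteq> b" "(p, q) \<in> edges a" "(r, s) \<in> edges b"
    "fst p < x" "x < fst q" "fst r < x" "x < fst s" "height (p, q) x = height (r, s) x"
    using assms by (rule crossing_pairs_cases) (auto simp: left_def right_def)
  have meet: "(x, height (p, q) x) = z" if "z \<in> {p, q}" "z \<in> {r, s}" for z
  proof (rule meet_unique[OF *(1-3)])
    show "a \<bullet> (x, height (p, q) x) = a \<bullet> z"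
      using level_on_edge[OF *(4), of x] edgesD(4)[OF *(4)] that by auto
    show "b \<bullet> (x, height (p, q) x) = b \<bullet> z"
      using level_on_edge[OF *(5), of x] edgesD(4)[OF *(5)] that *(10) by auto
  qed
  have "fst z = x" if "z \<in> {p, q}" "z \<in> {r, s}" for z
    using arg_cong[OF meet[OF that], of fst] by simp
  from this[of p] this[of q] show ?thesis using * by auto
qed

text \<open>Two normals and one line for each determine the crossing: the lines meet in one point,
  and on each line only one edge has it in its interior.\<close>

lemma card_crossing_pairs_le: "card crossing_pairs \<le> (card A * k) ^ 2"
proof -
  define Y where "Y a b = {x \<in> crossing_pairs. fst x \<in> edges a \<and> snd x \<in> edges b}" for a b
  have Y: "card (Y a b) \<le> k * k" if ab: "a \<in> A" "b \<in> A" "a \<noteq> b" for a b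
  proof -
    define lev where "lev x = (a \<bullet> fst (fst x), b \<bullet> fst (snd x))"
      for x :: "((real \<times> real) \<times> (real \<times> real)) \<times> ((real \<times> real) \<times> (real \<times> real))"
    have "inj_on lev (Y a b)"
    proof (rule inj_onI)
      fix u v assume u: "u \<in> Y a b" and v: "v \<in> Y a b" and uv: "lev u = lev v"
      obtain e f where ef: "u = (e, f)" by (cases u)
      obtain g h where gh: "v = (g, h)" by (cases v)
      have E: "e \<in> edges a" "f \<in> edges b" "g \<in> edges a" "h \<in> edges b"
        "crossing e f" "crossing g h"
        using u v by (auto simp: Y_def crossing_pairs_def ef gh)
      obtain x where x: "left e < x" "x < right e" "left f < x" "x < right f"
        "height e x = height f x"
        using E by (auto simp: crossing_def)
      obtain y where y: "left g < y" "y < right g" "left h < y" "y < right h"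
        "height g y = height h y"
        using E by (auto simp: crossing_def)
      have lev: "a \<bullet> fst e = a \<bullet> fst g" "b \<bullet> fst f = b \<bullet> fst h"
        using uv by (auto simp: lev_def ef gh)
      have "(x, height e x) = (y, height g y)"
      proof (rule meet_unique[OF ab])
        show "a \<bullet> (x, height e x) = a \<bullet> (y, height g y)"
          using level_on_edge[OF E(1)] level_on_edge[OF E(3)] lev by simp
        show "b \<bullet> (x, height e x) = b \<bullet> (y, height g y)"
          using level_on_edge[OF E(2)] level_on_edge[OF E(4)] lev x(5) y(5) by simp
      qed
      then have "x = y" by simp
      then show "u = v"
        using overlapping_edges_eq[OF E(1,3) lev(1)] overlapping_edges_eq[OF E(2,4) lev(2)] x y
        by (simp add: ef gh)
    qed
    moreover have "lev ` Y a b \<subseteq> ((\<bullet>) a ` P) \<times> ((\<bullet>) b ` P)"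
      using edgesD(1) by (fastforce simp: lev_def Y_def)
    ultimately have "card (Y a b) \<le> card (((\<bullet>) a ` P) \<times> ((\<bullet>) b ` P))"
      using finite_P by (intro card_inj_on_le) auto
    also have "\<dots> \<le> k * k"
      using card_levels ab by (simp add: card_cartesian_product mult_le_mono)
    finally show ?thesis .
  qed
  let ?D = "{(a, b) \<in> A \<times> A. a \<noteq> b}"
  have fD: "finite ?D" using finite_subset[of ?D "A \<times> A"] finite_A by auto
  have "crossing_pairs \<subseteq> (\<Union>(a, b)\<in>?D. Y a b)"
  proof
    fix u assume u: "u \<in> crossing_pairs"
    obtain e f where ef: "u = (e, f)" by (cases u)
    with u obtain a b where "a \<in> A" "b \<in> A" "a \<noteq> b" "e \<in> edges a" "f \<in> edges b"
      by (metis crossing_pairs_cases)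
    then have "(a, b) \<in> ?D" "u \<in> Y a b" using u by (auto simp: Y_def ef)
    then show "u \<in> (\<Union>(a, b)\<in>?D. Y a b)" by blast
  qed
  then have "card crossing_pairs \<le> card (\<Union>(a, b)\<in>?D. Y a b)"
    by (rule card_mono[rotated]) (use fD finite_crossing_pairs in \<open>auto simp: Y_def\<close>)
  also have "\<dots> \<le> (\<Sum>(a, b)\<in>?D. card (Y a b))"
    using card_UN_le[OF fD, of "\<lambda>(a, b). Y a b"] by (simp add: case_prod_unfold)
  also have "\<dots> \<le> (\<Sum>(a, b)\<in>?D. k * k)"
    using Y by (intro sum_mono) auto
  also have "\<dots> = card ?D * (k * k)"
    by (simp add: case_prod_unfold)
  also have "\<dots> \<le> card (A \<times> A) * (k * k)"
    using finite_A by (intro mult_le_mono1 card_mono) auto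
  finally show ?thesis
    by (simp add: card_cartesian_product power2_eq_square algebra_simps)
qed

text \<open>Discarding the edges that take part in a crossing leaves a plane graph, and at most one
  edge is lost per ordered crossing pair.\<close>

lemma induced_subgraph_bound:
  assumes S: "S \<subseteq> P"
  shows "card (all_edges \<inter> S \<times> S) \<le> 3 * card S + card (crossing_pairs \<inter> (S \<times> S) \<times> (S \<times> S))"
proof -
  let ?X = "crossing_pairs \<inter> (S \<times> S) \<times> (S \<times> S)"
  define F where "F = all_edges \<inter> S \<times> S - fst ` ?X"
  interpret plane_graph S F
  proof
    show "finite S" using finite_subset[OF S finite_P] .
    show "inj_on fst S" using inj_on_subset[OF inj_P S] .
    show "F \<subseteq> S \<times> S" by (auto simp: F_def)
    show "left e < right e" if "e \<in> F" for e
      using that edgesD(3) by (auto simp: F_def all_edges_def)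
    show "e = f" if "e \<in> F" "f \<in> F" "crossing e f" for e f
    proof (rule ccontr)
      assume "e \<noteq> f"
      with that have "(e, f) \<in> ?X" by (auto simp: F_def crossing_pairs_def)
      then have "e \<in> fst ` ?X" by force
      with that(1) show False by (simp add: F_def)
    qed
    show "snd v \<noteq> height e (fst v)"
      if "e \<in> F" "v \<in> S" "left e < fst v" "fst v < right e" for e v
    proof
      assume "snd v = height e (fst v)"
      then have v: "v = (fst v, height e (fst v))" by (simp add: prod_eq_iff)
      obtain a where a: "e \<in> edges a" using \<open>e \<in> F\<close> by (auto simp: F_def all_edges_def)
      have "a \<bullet> v = a \<bullet> fst e" by (subst v) (rule level_on_edge[OF a])
      then show False using edgesD(5)[OF a, of v] that S by blast
    qed
  qed
  have "card (all_edges \<inter> S \<times> S) \<le> card (F \<union> fst ` ?X)"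
    using finite_F finite_crossing_pairs by (intro card_mono) (auto simp: F_def)
  also have "\<dots> \<le> card F + card ?X"
    using card_Un_le[of F "fst ` ?X"] card_image_le[of ?X fst] finite_crossing_pairs by simp
  finally show ?thesis using card_edges_le by simp
qed

end

text \<open>Since \<open>12 * q \<le> A\<close>, the vertex term is at most a quarter of
  \<open>A * P * q ^ 2\<close>, while \<open>2 * k \<le> P\<close> makes \<open>M\<close> at least
  half of \<open>A * P\<close>. This leaves \<open>A * P * q ^ 2 \<le> 4 * (A * k) ^ 2\<close>, and
  \<open>A \<le> 24 * q\<close> gives the constant \<open>4 * 24 ^ 2 = 2304\<close>.\<close>

lemma crossing_count_arithmetic:
  fixes A P k q M Y :: nat
  assumes A: "12 \<le> A" and q: "q = A div 12" and P: "2 * k \<le> P"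
    and m: "M * q ^ 2 \<le> 3 * P * q ^ 3 + Y" and c: "Y \<le> (A * k) ^ 2"
    and ge: "A * P \<le> M + A * k"
  shows "P * A \<le> 2304 * k ^ 2"
proof -
  have q12: "12 * q \<le> A" unfolding q by simp
  have q24: "A \<le> 24 * q"
    using A unfolding q by presburger
  have main: "M * q ^ 2 \<le> 3 * P * q ^ 3 + (A * k) ^ 2"
    using m c by linarith
  have "2 * (A * k) \<le> A * P"
    using mult_le_mono2[OF P, of "A"] by (simp add: algebra_simps)
  then have "A * P \<le> 2 * M" using ge by linarith
  then have "A * P * q ^ 2 \<le> 2 * (M * q ^ 2)"
    using mult_le_mono1[of "A * P" "2 * M" "q ^ 2"] by (simp only: mult.assoc)
  moreover have "12 * (P * q ^ 3) \<le> A * P * q ^ 2"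
    using mult_le_mono1[OF q12, of "P * q ^ 2"]
    by (simp add: algebra_simps power2_eq_square power3_eq_cube)
  ultimately have "A * P * q ^ 2 \<le> 4 * (A * k) ^ 2"
    using main by linarith
  then have "576 * (A * P * q ^ 2) \<le> 576 * (4 * (A * k) ^ 2)" by (rule mult_le_mono2)
  moreover have "A * P * A ^ 2 \<le> A * P * (24 * q) ^ 2"
    using q24 by (intro mult_le_mono2 power_mono) auto
  moreover have "A * P * (24 * q) ^ 2 = 576 * (A * P * q ^ 2)"
    by (simp add: power_mult_distrib)
  ultimately have "(A * P) * A ^ 2 \<le> 576 * (4 * (A * k) ^ 2)"
    by linarith
  also have "\<dots> = (2304 * k ^ 2) * A ^ 2"
    by (simp add: power_mult_distrib)
  finally have "A * P \<le> 2304 * k ^ 2"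
    using A by simp
  then show ?thesis by (simp add: mult.commute)
qed

lemma (in parallel_families) card_points_mult_directions_le:
  assumes P: "2 * k \<le> card P" and A: "12 \<le> card A"
  shows "card P * card A \<le> 2304 * k ^ 2"
proof (rule crossing_count_arithmetic[OF A refl P _ card_crossing_pairs_le card_all_edges_ge])
  show "card all_edges * (card A div 12) ^ 2 \<le> 3 * card P * (card A div 12) ^ 3 + card crossing_pairs"
  proof (rule crossing_amplification[OF finite_P all_edges_sub _ _ crossing_pairs_distinct induced_subgraph_bound])
    show "a \<noteq> b" if "(a, b) \<in> all_edges" for a b
      using that by (auto simp: all_edges_def edges_def left_def right_def)
    show "crossing_pairs \<subseteq> all_edges \<times> all_edges" by (auto simp: crossing_pairs_def)
    show "1 \<le> card A div 12" using A by simp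
  qed
qed

section \<open>Reduction to the plane\<close>

lemma finite_spanned_by_few_and_two:
  fixes E :: "'a::euclidean_space set"
  obtains B b c where "B \<subseteq> E" "finite B" "card B \<le> DIM('a) - 2" "E \<subseteq> span (insert b (insert c B))"
proof -
  obtain B where B: "B \<subseteq> E" "independent B" "E \<subseteq> span B"
    using maximal_independent_subset by blast
  then have fin: "finite B" and card: "card B \<le> DIM('a)"
    using independent_bound by auto
  show thesis
  proof (cases "\<exists>b\<in>B. \<exists>c\<in>B. b \<noteq> c")
    case True
    then obtain b c where bc: "b \<in> B" "c \<in> B" "b \<noteq> c" by blast
    show thesis
    proof (rule that[of "B - {b, c}" b c])
      show "card (B - {b, c}) \<le> DIM('a) - 2"
        using bc fin card by (simp add: card_Diff_subset)
      have "insert b (insert c (B - {b, c})) = B" using bc by blast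
      then show "E \<subseteq> span (insert b (insert c (B - {b, c})))" using B by simp
    qed (use B fin in auto)
  next
    case False
    \<comment> \<open>With at most one basis vector, the fixed set is empty and the vector is used
      twice.\<close>
    then obtain b where "B \<subseteq> {b}" by blast
    then have "span B \<subseteq> span (insert b (insert b {}))" by (intro span_mono) auto
    then show thesis using that[of "{}" b b] B by auto
  qed
qed

text \<open>Pigeonhole, one vector of \<open>B\<close> at a time: it takes at most \<open>k\<close>
  values on the current fibre, so the most popular value keeps a share of at least
  \<open>1 / k\<close>.\<close>

lemma card_le_fibre:
  fixes E B :: "'a::real_inner set"
  assumes E: "finite E" and B: "finite B" and k: "\<And>c. c \<in> B \<Longrightarrow> card ((\<bullet>) c ` E) \<le> k"
  obtains S where "S \<subseteq> E" "card E \<le> card S * k ^ card B"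
    "\<And>c y z. c \<in> B \<Longrightarrow> y \<in> S \<Longrightarrow> z \<in> S \<Longrightarrow> c \<bullet> y = c \<bullet> z"
  using B k
proof (induction arbitrary: thesis)
  case empty
  show ?case by (rule empty(1)[of E]) auto
next
  case (insert c B)
  obtain S where S: "S \<subseteq> E" "card E \<le> card S * k ^ card B"
    "\<And>c y z. c \<in> B \<Longrightarrow> y \<in> S \<Longrightarrow> z \<in> S \<Longrightarrow> c \<bullet> y = c \<bullet> z"
    using insert.IH insert.prems(2) by (metis insertCI)
  define T where "T v = {y \<in> S. c \<bullet> y = v}" for v
  have fS: "finite S" using finite_subset[OF S(1) E] .
  show ?case
  proof (cases "S = {}")
    case True
    then show ?thesis using insert.prems(1)[of "{}"] S(2) by simp
  next
    case False
    let ?M = "Max ((\<lambda>v. card (T v)) ` ((\<bullet>) c ` S))"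
    have "?M \<in> (\<lambda>v. card (T v)) ` ((\<bullet>) c ` S)"
      using False fS by (intro Max_in) auto
    then obtain v where v: "?M = card (T v)" by blast
    have max: "card (T u) \<le> card (T v)" if "u \<in> (\<bullet>) c ` S" for u
      unfolding v[symmetric] using that fS by (intro Max_ge) auto
    have "card S = card (\<Union>v\<in>(\<bullet>) c ` S. T v)"
      by (rule arg_cong[of _ _ card]) (auto simp: T_def)
    also have "\<dots> \<le> (\<Sum>v\<in>(\<bullet>) c ` S. card (T v))"
      using fS by (intro card_UN_le) auto
    also have "\<dots> \<le> card ((\<bullet>) c ` S) * card (T v)"
      using sum_bounded_above[of "(\<bullet>) c ` S" "\<lambda>u. card (T u)" "card (T v)"] max by simp
    also have "\<dots> \<le> k * card (T v)"
      using insert.prems(2)[of c] card_mono[OF finite_imageI[OF E] image_mono[OF S(1)], of "(\<bullet>) c"]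
      by (intro mult_le_mono1) simp
    finally have "card S \<le> k * card (T v)" .
    then have "card E \<le> k * card (T v) * k ^ card B"
      using S(2) mult_le_mono1 order_trans by blast
    then show ?thesis
      using insert.hyps S by (intro insert.prems(1)[of "T v"]) (auto simp: T_def algebra_simps)
  qed
qed

text \<open>In the plane of the products with \<open>b\<close> and \<open>c\<close>, each
  \<open>x\<close> yields at most \<open>k\<close> parallel lines covering \<open>S\<close>, and few
  points share a direction, so the bound for \<open>parallel_families\<close> applies.\<close>

lemma card_planar_slice_le:
  fixes S :: "'a::real_inner set"
  assumes S: "finite S" and k: "1 \<le> k" "\<And>x. x \<in> S \<Longrightarrow> card ((\<bullet>) x ` S) \<le> k"
    and planar: "\<And>x. x \<in> S \<Longrightarrow> \<exists>\<alpha> \<beta>. \<forall>y\<in>S. \<forall>z\<in>S. x \<bullet> (y - z) = \<alpha> * (b \<bullet> (y - z)) + \<beta> * (c \<bullet> (y - z))"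
  shows "(card S) ^ 2 \<le> 4608 * k ^ 3"
proof -
  \<comment> \<open>A difference annihilated by \<open>b\<close> and \<open>c\<close> is orthogonal
    to \<open>y\<close> and \<open>z\<close>, hence to itself.\<close>
  have bc: "b \<bullet> (y - z) \<noteq> 0 \<or> c \<bullet> (y - z) \<noteq> 0" if yz: "y \<in> S" "z \<in> S" "y \<noteq> z" for y z
  proof (rule ccontr)
    assume "\<not> ?thesis"
    then have "y \<bullet> (y - z) = 0" "z \<bullet> (y - z) = 0"
      using planar[OF yz(1)] planar[OF yz(2)] yz by auto
    then have "(y - z) \<bullet> (y - z) = 0" by (simp add: inner_diff_left)
    then show False using yz by simp
  qed
  have "finite ((\<lambda>(y, z). - (b \<bullet> (y - z)) / (c \<bullet> (y - z))) ` (S \<times> S))"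
    using S by simp
  then obtain t where t: "t \<notin> (\<lambda>(y, z). - (b \<bullet> (y - z)) / (c \<bullet> (y - z))) ` (S \<times> S)"
    using ex_new_if_finite infinite_UNIV_char_0 by blast
  \<comment> \<open>A generic replacement for \<open>b\<close>, making the first planar coordinate injective on \<open>S\<close>.\<close>
  define d where "d = b + t *\<^sub>R c"
  have d: "d \<bullet> (y - z) \<noteq> 0" if yz: "y \<in> S" "z \<in> S" "y \<noteq> z" for y z
  proof
    assume "d \<bullet> (y - z) = 0"
    then have eq: "b \<bullet> (y - z) + t * (c \<bullet> (y - z)) = 0" by (simp add: d_def inner_add_left)
    then have "c \<bullet> (y - z) \<noteq> 0" using bc[OF yz] by auto
    then have "t = - (b \<bullet> (y - z)) / (c \<bullet> (y - z))" using eq by (simp add: field_simps)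
    then show False using t yz by force
  qed
  define \<pi> where "\<pi> y = (d \<bullet> y, c \<bullet> y)" for y
  have "\<exists>a. \<forall>y\<in>S. \<forall>z\<in>S. x \<bullet> (y - z) = a \<bullet> \<pi> (y - z)" if x: "x \<in> S" for x
  proof -
    obtain \<alpha> \<beta> where "\<forall>y\<in>S. \<forall>z\<in>S. x \<bullet> (y - z) = \<alpha> * (b \<bullet> (y - z)) + \<beta> * (c \<bullet> (y - z))"
      using planar[OF x] by blast
    \<comment> \<open>In terms of \<open>d\<close>, the functional
      \<open>\<alpha> b + \<beta> c\<close> is
      \<open>\<alpha> d + (\<beta> - \<alpha> t) c\<close>.\<close>
    then have "\<forall>y\<in>S. \<forall>z\<in>S. x \<bullet> (y - z) = (\<alpha>, \<beta> - \<alpha> * t) \<bullet> \<pi> (y - z)"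
      by (simp add: \<pi>_def d_def inner_add_left algebra_simps)
    then show ?thesis by blast
  qed
  then obtain a where a: "\<And>x y z. x \<in> S \<Longrightarrow> y \<in> S \<Longrightarrow> z \<in> S \<Longrightarrow> x \<bullet> (y - z) = a x \<bullet> \<pi> (y - z)"
    by metis
  have \<pi>_diff: "\<pi> (y - z) = \<pi> y - \<pi> z" for y z
    by (simp add: \<pi>_def inner_diff_right)
  have eqI: "y = z" if "y \<in> S" "z \<in> S" "y \<bullet> (y - z) = 0" "z \<bullet> (y - z) = 0" for y z
  proof -
    have "(y - z) \<bullet> (y - z) = 0" using that by (simp add: inner_diff_left)
    then show ?thesis by simp
  qed
  \<comment> \<open>Parallelism; not transitive through the zero vector.\<close>
  define par where "par u v \<longleftrightarrow> (\<exists>z. z \<noteq> 0 \<and> u \<bullet> z = 0 \<and> v \<bullet> z = 0)" for u v :: "real \<times> real"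
  have par_refl: "par u u" for u
    unfolding par_def
    by (rule exI[of _ "if u = 0 then (1, 0) else (- snd u, fst u)"])
      (auto simp: inner_prod_def prod_eq_iff)
  \<comment> \<open>In the plane, the vectors orthogonal to a nonzero \<open>u\<close> form a single
    line, here spanned by \<open>w\<close>.\<close>
  have par_trans: "v \<bullet> z = 0" if "u \<noteq> 0" "par u v" "u \<bullet> z = 0" for u v z :: "real \<times> real"
  proof -
    obtain w where w: "w \<noteq> 0" "u \<bullet> w = 0" "v \<bullet> w = 0" using \<open>par u v\<close> by (auto simp: par_def)
    have "fst w * snd z = snd w * fst z"
      using \<open>u \<noteq> 0\<close> w(2) \<open>u \<bullet> z = 0\<close> by (simp add: inner_prod_def prod_eq_iff) algebra
    then show ?thesis
      using w(1,3) by (simp add: inner_prod_def prod_eq_iff) algebra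
  qed
  define S0 where "S0 = {x \<in> S. a x \<noteq> 0}"
  have S0: "finite S0" "S0 \<subseteq> S" using S by (auto simp: S0_def)
  \<comment> \<open>If \<open>y\<close> and \<open>z\<close> both have normal zero, both are
    orthogonal to \<open>y - z\<close>; so at most one point is lost.\<close>
  have "card (S - S0) \<le> 1"
  proof -
    have "y = z" if "y \<in> S - S0" "z \<in> S - S0" for y z
      using that a[of y y z] a[of z y z] by (intro eqI) (auto simp: S0_def)
    then show ?thesis using card_le_Suc0_iff_eq[of "S - S0"] S by auto
  qed
  then have card_S: "card S \<le> card S0 + 1"
    using card_Diff_subset[OF S0] card_mono[OF S S0(2)] by simp
  \<comment> \<open>A maximal set with pairwise non-parallel normals represents every direction
    once.\<close>
  define family where "family = {R. R \<subseteq> S0 \<and> (\<forall>x\<in>R. \<forall>y\<in>R. x \<noteq> y \<longrightarrow> \<not> par (a x) (a y))}"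
  have "finite family" using S0(1) by (simp add: family_def)
  moreover have "{} \<in> family" by (simp add: family_def)
  ultimately obtain R where R: "R \<in> family" and R_max: "\<And>T. T \<in> family \<Longrightarrow> R \<subseteq> T \<Longrightarrow> T = R"
    using finite_has_maximal[of family] by (metis empty_iff)
  have RS0: "R \<subseteq> S0" and Rpar: "\<And>x y. x \<in> R \<Longrightarrow> y \<in> R \<Longrightarrow> x \<noteq> y \<Longrightarrow> \<not> par (a x) (a y)"
    using R by (auto simp: family_def)
  have fR: "finite R" using finite_subset[OF RS0 S0(1)] .
  define C where "C x = {y \<in> S0. par (a x) (a y)}" for x
  \<comment> \<open>Products with \<open>x\<close> separate its class: if \<open>y\<close> and
    \<open>z\<close> agree, the normal of \<open>x\<close> annihilates their difference, hence so do
    the parallel normals of \<open>y\<close> and \<open>z\<close>.\<close>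
  have C: "card (C x) \<le> k" if x: "x \<in> R" for x
  proof -
    have xS: "x \<in> S" "a x \<noteq> 0" using x RS0 by (auto simp: S0_def)
    have "inj_on ((\<bullet>) x) (C x)"
    proof (rule inj_onI)
      fix y z assume yz: "y \<in> C x" "z \<in> C x" "x \<bullet> y = x \<bullet> z"
      then have S': "y \<in> S" "z \<in> S" by (auto simp: C_def S0_def)
      then have "a x \<bullet> \<pi> (y - z) = 0"
        using a[OF xS(1) S'] yz(3) by (simp add: inner_diff_right)
      then have "a y \<bullet> \<pi> (y - z) = 0" "a z \<bullet> \<pi> (y - z) = 0"
        using par_trans[OF xS(2)] yz by (auto simp: C_def)
      then show "y = z" using a S' by (intro eqI) auto
    qed
    then have "card (C x) \<le> card ((\<bullet>) x ` S)"
      using S S0 by (intro card_inj_on_le) (auto simp: C_def)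
    then show ?thesis using k(2)[OF xS(1)] by simp
  qed
  have "S0 \<subseteq> (\<Union>x\<in>R. C x)"
  proof
    fix y assume y: "y \<in> S0"
    show "y \<in> (\<Union>x\<in>R. C x)"
    proof (rule ccontr)
      assume "y \<notin> (\<Union>x\<in>R. C x)"
      then have np: "\<not> par (a x) (a y)" if "x \<in> R" for x using y that by (auto simp: C_def)
      then have "insert y R \<in> family"
        using y RS0 Rpar by (auto simp: family_def par_def)
      then have "insert y R = R" using R_max by blast
      then have "y \<in> R" by blast
      then show False using np par_refl by blast
    qed
  qed
  then have "card S0 \<le> card (\<Union>x\<in>R. C x)"
    using fR S0 by (intro card_mono) (auto simp: C_def)
  also have "\<dots> \<le> (\<Sum>x\<in>R. card (C x))" using fR by (rule card_UN_le)
  also have "\<dots> \<le> card R * k" using sum_bounded_above[of R "\<lambda>x. card (C x)" k] C by simp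
  finally have card_R: "card S \<le> card R * k + 1" using card_S by simp
  have inj_a: "inj_on a R"
  proof (rule inj_onI, rule ccontr)
    fix x y assume xy: "x \<in> R" "y \<in> R" "a x = a y" "x \<noteq> y"
    show False using Rpar[OF xy(1,2,4)] par_refl xy(3) by simp
  qed
  interpret parallel_families "\<pi> ` S" "a ` R" k
  proof
    show "finite (\<pi> ` S)" "finite (a ` R)" using S fR by auto
    show "inj_on fst (\<pi> ` S)"
      using d by (fastforce simp: inj_on_def \<pi>_def inner_diff_right)
    show "z = 0" if uv: "u \<in> a ` R" "v \<in> a ` R" "u \<noteq> v" "u \<bullet> z = 0" "v \<bullet> z = 0" for u v z
    proof -
      obtain x y where "x \<in> R" "y \<in> R" "u = a x" "v = a y" using uv(1,2) by blast
      then show ?thesis using Rpar[of x y] uv(3-5) unfolding par_def by blast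
    qed
    show "card ((\<bullet>) u ` \<pi> ` S) \<le> k" if u: "u \<in> a ` R" for u
    proof -
      obtain x where x: "x \<in> R" "u = a x" using u by blast
      then have xS: "x \<in> S" using RS0 S0 by blast
      \<comment> \<open>On \<open>S\<close> the planar functional differs from the product with
        \<open>x\<close> by a constant, so it takes no more values.\<close>
      have "u \<bullet> \<pi> y = x \<bullet> y + (u \<bullet> \<pi> x - x \<bullet> x)" if "y \<in> S" for y
        using a[OF xS that xS] by (simp add: \<pi>_diff inner_diff_right x)
      then have "(\<bullet>) u ` \<pi> ` S \<subseteq> (\<lambda>r. r + (u \<bullet> \<pi> x - x \<bullet> x)) ` ((\<bullet>) x ` S)"
        by auto
      then have "card ((\<bullet>) u ` \<pi> ` S) \<le> card ((\<bullet>) x ` S)"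
        using S by (intro surj_card_le) auto
      then show ?thesis using k(2)[OF xS] by simp
    qed
  qed
  have "inj_on \<pi> S"
    using d by (fastforce simp: inj_on_def \<pi>_def inner_diff_right)
  then have cards: "card (\<pi> ` S) = card S" "card (a ` R) = card R"
    using inj_a by (simp_all add: card_image)
  have k3: "k ^ 2 \<le> k ^ 3" using k(1) by (intro power_increasing) auto
  \<comment> \<open>With few points or few directions, \<open>card S\<close> is at most
    \<open>12 * k\<close> and the claim is immediate.\<close>
  consider "card S < 2 * k" | "card R < 12" | "2 * k \<le> card S" "12 \<le> card R" by linarith
  then show ?thesis
  proof cases
    case 1
    then have "(card S) ^ 2 \<le> (2 * k) ^ 2" by (intro power_mono) auto
    then show ?thesis using k3 by (simp add: power_mult_distrib)
  next
    case 2
    then have "card R * k \<le> 11 * k" by (intro mult_le_mono1) simp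
    then have "card S \<le> 12 * k" using card_R k(1) by linarith
    then have "(card S) ^ 2 \<le> (12 * k) ^ 2" by (intro power_mono) auto
    then show ?thesis using k3 by (simp add: power_mult_distrib)
  next
    case 3
    then have main: "card S * card R \<le> 2304 * k ^ 2"
      using card_points_mult_directions_le by (simp add: cards)
    \<comment> \<open>A factor 2 absorbs the extra point in \<open>card_R\<close>, turning 2304 into
      4608.\<close>
    have "card S \<le> 2 * (card R * k)" using card_R 3 k(1) by linarith
    then have "card S * card S \<le> card S * (2 * (card R * k))" by (rule mult_le_mono2)
    also have "\<dots> = 2 * (card S * card R) * k" by simp
    also have "\<dots> \<le> 2 * (2304 * k ^ 2) * k" using main by (intro mult_le_mono1 mult_le_mono2)
    finally show ?thesis by (simp add: power2_eq_square power3_eq_cube)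
  qed
qed

text \<open>Passing to a planar slice costs a factor of at most \<open>k ^ (d - 2)\<close> with
  \<open>d = DIM('a)\<close>; after squaring, the exponent is
  \<open>3 + 2 * (d - 2) = 2 * d - 1\<close>.\<close>

lemma card_sq_le_pinned_power:
  fixes E :: "'a::euclidean_space set"
  assumes E: "finite E" and dim: "2 \<le> DIM('a)" and k: "1 \<le> k"
    "\<And>x. x \<in> E \<Longrightarrow> card ((\<bullet>) x ` E) \<le> k"
  shows "(card E) ^ 2 \<le> 4608 * k ^ (2 * DIM('a) - 1)"
proof -
  obtain B b c where B: "B \<subseteq> E" "finite B" "card B \<le> DIM('a) - 2"
    "E \<subseteq> span (insert b (insert c B))"
    using finite_spanned_by_few_and_two .
  obtain S where S: "S \<subseteq> E" "card E \<le> card S * k ^ card B"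
    "\<And>c y z. c \<in> B \<Longrightarrow> y \<in> S \<Longrightarrow> z \<in> S \<Longrightarrow> c \<bullet> y = c \<bullet> z"
    using card_le_fibre[OF E B(2)] k(2) B(1) by (metis subsetD)
  have fS: "finite S" using finite_subset[OF S(1) E] .
  have "(card S) ^ 2 \<le> 4608 * k ^ 3"
  proof (rule card_planar_slice_le[OF fS k(1)])
    show "card ((\<bullet>) x ` S) \<le> k" if "x \<in> S" for x
      using k(2)[of x] that S(1) card_mono[OF finite_imageI[OF E] image_mono[OF S(1)], of "(\<bullet>) x"]
      by (meson order_trans subsetD)
    show "\<exists>\<alpha> \<beta>. \<forall>y\<in>S. \<forall>z\<in>S. x \<bullet> (y - z) = \<alpha> * (b \<bullet> (y - z)) + \<beta> * (c \<bullet> (y - z))"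
      if x: "x \<in> S" for x
    proof -
      obtain \<alpha> where "x - \<alpha> *\<^sub>R b \<in> span (insert c B)"
        using x S(1) B(4) span_breakdown_eq[of x b "insert c B"] by blast
      then obtain \<beta> where r: "x - \<alpha> *\<^sub>R b - \<beta> *\<^sub>R c \<in> span B"
        using span_breakdown_eq[of _ c B] by blast
      have "x \<bullet> (y - z) = \<alpha> * (b \<bullet> (y - z)) + \<beta> * (c \<bullet> (y - z))" if yz: "y \<in> S" "z \<in> S" for y z
      proof -
        \<comment> \<open>The remainder lies in the span of \<open>B\<close>, and the products with
          members of \<open>B\<close> are constant on \<open>S\<close>.\<close>
        have "orthogonal (y - z) (x - \<alpha> *\<^sub>R b - \<beta> *\<^sub>R c)"
          using S(3)[OF _ yz]
          by (intro orthogonal_to_span[OF r]) (simp add: orthogonal_def inner_diff_right inner_commute)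
        then show ?thesis
          by (simp add: orthogonal_def inner_diff_right inner_diff_left inner_commute algebra_simps)
      qed
      then show ?thesis by blast
    qed
  qed
  have "card E \<le> card S * k ^ (DIM('a) - 2)"
    using S(2) B(3) k(1) by (meson mult_le_mono2 order_trans power_increasing)
  then have "(card E) ^ 2 \<le> (card S * k ^ (DIM('a) - 2)) ^ 2" by (intro power_mono) auto
  also have "\<dots> = (card S) ^ 2 * k ^ (2 * (DIM('a) - 2))"
    by (simp add: power_mult_distrib power_mult mult.commute flip: power_mult)
  also have "\<dots> \<le> (4608 * k ^ 3) * k ^ (2 * (DIM('a) - 2))"
    using \<open>(card S) ^ 2 \<le> 4608 * k ^ 3\<close> by (rule mult_le_mono1)
  also have "\<dots> = 4608 * k ^ (3 + 2 * (DIM('a) - 2))" by (simp add: power_add)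
  also have "3 + 2 * (DIM('a) - 2) = 2 * DIM('a) - 1" using dim by simp
  finally show ?thesis .
qed

section \<open>From the polynomial inequality to the exponent\<close>

theorem theorem1p2:
  assumes "CARD('d::finite) \<ge> 2"
  shows "\<exists>c::real. c > 0 \<and> (\<exists>N::nat. \<forall>(E::(real ^ 'd) set) n::nat.
           finite E \<longrightarrow> card E = n \<longrightarrow> n \<ge> N \<longrightarrow>
           (\<exists>x\<in>E. real (card {x \<bullet> y | y. y \<in> E})
                    \<ge> c * real n powr (2 / (2 * real CARD('d) - 1))))"
proof -
  define e where "e = 2 * CARD('d) - 1"
  have e: "real e = 2 * real CARD('d) - 1" "0 < e" using assms by (auto simp: e_def of_nat_diff)
  \<comment> \<open>Comes from solving \<open>card E ^ 2 \<le> 4608 * k ^ e\<close> for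
    \<open>k\<close>.\<close>
  define c where "c = (1 / 4608) powr (1 / real e)"
  have "\<exists>x\<in>E. c * real (card E) powr (2 / real e) \<le> real (card {x \<bullet> y | y. y \<in> E})"
    if E: "finite E" "1 \<le> card E" for E :: "(real ^ 'd) set"
  proof -
    \<comment> \<open>The point \<open>x\<close> maximises the pinned count, so \<open>k\<close>
      bounds all pinned counts and is attained at \<open>x\<close>.\<close>
    let ?K = "(\<lambda>x. card ((\<bullet>) x ` E)) ` E"
    have ne: "E \<noteq> {}" using E by auto
    then have "Max ?K \<in> ?K" using E by (intro Max_in) auto
    then obtain x where x: "x \<in> E" "Max ?K = card ((\<bullet>) x ` E)" by blast
    define k where "k = card ((\<bullet>) x ` E)"
    have k1: "1 \<le> k" using E ne by (simp add: k_def Suc_le_eq card_gt_0_iff)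
    have "card ((\<bullet>) y ` E) \<le> k" if "y \<in> E" for y
      unfolding k_def x(2)[symmetric] using that E by simp
    then have "(card E) ^ 2 \<le> 4608 * k ^ e"
      using card_sq_le_pinned_power[OF E(1) _ k1] assms by (simp add: e_def)
    then have "real ((card E) ^ 2) \<le> real (4608 * k ^ e)" by (rule of_nat_mono)
    then have le: "1 / 4608 * real (card E) ^ 2 \<le> real k ^ e" by simp
    have "(real (card E) ^ 2) powr (1 / real e) = real (card E) powr (2 / real e)"
      using powr_powr[of "real (card E)" 2 "1 / real e"] E by (simp add: powr_numeral)
    then have "c * real (card E) powr (2 / real e) = (1 / 4608 * real (card E) ^ 2) powr (1 / real e)"
      using powr_mult[of "1 / 4608" "real (card E) ^ 2" "1 / real e"] by (simp add: c_def)
    also have "\<dots> \<le> (real k ^ e) powr (1 / real e)"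
      using le by (intro powr_mono2) auto
    also have "\<dots> = real k"
      using powr_powr[of "real k" "real e" "1 / real e"] powr_realpow[of "real k" e] k1 e(2) by simp
    also have "(\<bullet>) x ` E = {x \<bullet> y | y. y \<in> E}" by auto
    then have "real k = real (card {x \<bullet> y | y. y \<in> E})" by (simp add: k_def)
    finally show ?thesis using x(1) by blast
  qed
  moreover have "0 < c" by (simp add: c_def)
  \<comment> \<open>The bound holds for every nonempty finite \<open>E\<close>, so the threshold is
    1.\<close>
  ultimately show ?thesis
    unfolding e(1)[symmetric] by (intro exI[of _ c] conjI exI[of _ 1]) auto
qed

end
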